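(* Let $n=1$, let $\alpha$ satisfy Hypothesis (H) of the context, let $g:[0,\infty)\to\mathbb{R}$ be continuous and of at most polynomial growth, and let $u$ be the solution of the Black-Scholes equation with initial condition $g$ (as defined in the context). Assume that $g$ is convex and that $g'(0+)>-\infty$. Then the (one-sided, finite) spatial derivative $u_x(0,t)$ exists for all $t\ge 0$. Moreover, the function $t\mapsto u_x(0,t)$ is increasing (in the non-strict sense) and upper semi-continuous.
   Context: Fix $T\in\mathbb{R}$. Hypothesis (H) (for $n=1$). The real-valued function $\alpha=\alpha(x,t)$ is defined on $[0,\infty)\times(-\infty,T]$ and: (i) $\alpha$ is continuous in the time variable, and is Hölder continuous with exponent $1/2$ (for instance Lipschitz continuous) in the spatial variable on every compact subset of $(0,\infty)\times(-\infty,T]$; moreover $|\alpha(x,t)|\le K(1+x)$ for some constant $K$; (ii) $\alpha(0,t)=0$ for all $t$; (iii) $\alpha(x,t)\ne 0$ for all $x>0$ and all $t$. Discontinuities of $\alpha$ at $x=0$ are allowed. For $t\ge 0$ set $a(x,t):=\tfrac12\alpha(x,T-t)^2$. Black-Scholes equation. $u$ is the unique classical solution of at most polynomial growth (i.e. continuous on $[0,\infty)\times[0,\infty)$, twice continuously differentiable in $x$ and once in $t$ on $(0,\infty)\times(0,\infty)$, and of at most polynomial growth in $x$ uniformly on bounded time intervals) of $$a(x,t)u_{xx}-u_t=0\ \text{ in }(0,\infty)\times(0,\infty),\qquad u(x,0)=g(x),\qquad u(0,t)=g(0)\ \text{ for } t\ge 0.$$ Existence and uniqueness of this solution are known. Here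 $g'(0+)$ denotes the right derivative of the convex function $g$ at $0$. *)

theory Defs
  imports "HOL-Analysis.Analysis"
begin

text \<open>
  Functions on $[0,\infty)$ or $[0,\infty)\times(-\infty,T]$ are modelled by total functions
  on \<^typ>\<open>real\<close>; only their values on the stated domain are ever referred to.
  Condition (i): Hoelder continuity with exponent 1/2 in the spatial variable, with one constant
  for each compact \<open>C\<close>; joint continuity of \<open>\<alpha>\<close> is not assumed, and
  \<open>\<alpha>\<close> may be discontinuous in \<open>x\<close> at \<open>x = 0\<close>.
\<close>

definition hypothesis_H :: "real \<Rightarrow> (real \<Rightarrow> real \<Rightarrow> real) \<Rightarrow> bool" where
  "hypothesis_H T \<alpha> \<longleftrightarrow>
     (\<forall>x\<ge>0. continuous_on {..T} (\<lambda>t. \<alpha> x t)) \<and>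
     (\<forall>C. compact C \<and> C \<subseteq> {0<..} \<times> {..T} \<longrightarrow>
        (\<exists>L. \<forall>x y t. (x, t) \<in> C \<and> (y, t) \<in> C \<longrightarrow>
           \<bar>\<alpha> x t - \<alpha> y t\<bar> \<le> L * \<bar>x - y\<bar> powr (1/2))) \<and>
     (\<exists>K. \<forall>x\<ge>0. \<forall>t\<le>T. \<bar>\<alpha> x t\<bar> \<le> K * (1 + x)) \<and>
     (\<forall>t\<le>T. \<alpha> 0 t = 0) \<and>
     (\<forall>x>0. \<forall>t\<le>T. \<alpha> x t \<noteq> 0)"

definition bs_coeff :: "real \<Rightarrow> (real \<Rightarrow> real \<Rightarrow> real) \<Rightarrow> real \<Rightarrow> real \<Rightarrow> real" where
  "bs_coeff T \<alpha> x t = 1/2 * (\<alpha> x (T - t))\<^sup>2"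

definition poly_growth :: "(real \<Rightarrow> real) \<Rightarrow> bool" where
  "poly_growth g \<longleftrightarrow> (\<exists>C. \<exists>k::nat. \<forall>x\<ge>0. \<bar>g x\<bar> \<le> C * (1 + x) ^ k)"

text \<open>The constant and the exponent may depend on the bounded time interval.\<close>

definition poly_growth_loc_unif :: "(real \<Rightarrow> real \<Rightarrow> real) \<Rightarrow> bool" where
  "poly_growth_loc_unif u \<longleftrightarrow>
     (\<forall>S\<ge>0. \<exists>C. \<exists>k::nat. \<forall>x\<ge>0. \<forall>t\<in>{0..S}. \<bar>u x t\<bar> \<le> C * (1 + x) ^ k)"

text \<open>
  The functions \<open>ux\<close>, \<open>uxx\<close>, \<open>ut\<close> are the partial
  derivatives $u_x$, $u_{xx}$, $u_t$ on the open quadrant, where they are jointly continuous.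
\<close>

definition bs_solution ::
  "real \<Rightarrow> (real \<Rightarrow> real \<Rightarrow> real) \<Rightarrow> (real \<Rightarrow> real) \<Rightarrow> (real \<Rightarrow> real \<Rightarrow> real) \<Rightarrow> bool" where
  "bs_solution T \<alpha> g u \<longleftrightarrow>
     continuous_on ({0..} \<times> {0..}) (\<lambda>(x, t). u x t) \<and>
     (\<exists>ux uxx ut.
        continuous_on ({0<..} \<times> {0<..}) (\<lambda>(x, t). ux x t) \<and>
        continuous_on ({0<..} \<times> {0<..}) (\<lambda>(x, t). uxx x t) \<and>
        continuous_on ({0<..} \<times> {0<..}) (\<lambda>(x, t). ut x t) \<and>
        (\<forall>x>0. \<forall>t>0.
           ((\<lambda>y. u y t) has_real_derivative ux x t) (at x) \<and>
           ((\<lambda>y. ux y t) has_real_derivative uxx x t) (at x) \<and>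
           ((\<lambda>s. u x s) has_real_derivative ut x t) (at t) \<and>
           bs_coeff T \<alpha> x t * uxx x t - ut x t = 0)) \<and>
     poly_growth_loc_unif u \<and>
     (\<forall>x\<ge>0. u x 0 = g x) \<and>
     (\<forall>t\<ge>0. u 0 t = g 0)"

text \<open>
  Right derivative with values in $[-\infty,\infty]$. For a convex function on $[0,\infty)$
  it always exists at \<open>0\<close>, with a value in $[-\infty,\infty)$.
\<close>

definition has_ext_right_derivative :: "(real \<Rightarrow> real) \<Rightarrow> ereal \<Rightarrow> real \<Rightarrow> bool" where
  "has_ext_right_derivative f D x \<longleftrightarrow>
     ((\<lambda>y. ereal ((f y - f x) / (y - x))) \<longlongrightarrow> D) (at_right x)"

definition upper_semicontinuous_on :: "'a::topological_space set \<Rightarrow> ('a \<Rightarrow> real) \<Rightarrow> bool" where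
  "upper_semicontinuous_on S f \<longleftrightarrow>
     (\<forall>x\<in>S. \<forall>a>f x. \<forall>\<^sub>F y in at x within S. f y < a)"

end

theory Submission
  imports Defs
begin

text \<open>
  Put \<open>E(x,z,y,t) = (y-z) u(x,t) + (z-x) u(y,t) - (y-x) u(z,t)\<close>. Being affine in
  the two variables that do not enter the respective copy of \<open>u\<close>, it solves
  $E_t = a(x,t) E_{xx} + a(z,t) E_{zz} + a(y,t) E_{yy}$ on $0 \le x \le z \le y$, it vanishes for
  $x = z$ and for $z = y$, and it is nonnegative for $t = 0$. The maximum principle gives
  $E \ge 0$, so convexity in \<open>x\<close> is preserved, without any differentiation of the
  coefficient. Hence $u_t = a u_{xx} \ge 0$, and $u_x(0,t)$ is the infimum over $x > 0$ of the
  quotients $(u(x,t) - g(0))/x$, which are monotone in \<open>x\<close>, nondecreasing and continuous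
  in \<open>t\<close>, and bounded below by $g'(0+)$.
\<close>

section \<open>Derivative tests at minima\<close>

text \<open>If \<open>D\<close> were negative, \<open>f'\<close> would be 0 at \<open>x\<close> and
  negative just to the right of it, so the mean value theorem would produce a value of
  \<open>f\<close> below \<open>f x\<close>.\<close>

lemma second_derivative_nonneg_at_local_min:
  fixes f f' :: "real \<Rightarrow> real"
  assumes "0 < d"
    and f': "\<And>y. \<bar>y - x\<bar> < d \<Longrightarrow> (f has_real_derivative f' y) (at y)"
    and f'': "(f' has_real_derivative D) (at x)"
    and min: "\<And>y. \<bar>y - x\<bar> < d \<Longrightarrow> f x \<le> f y"
  shows "0 \<le> D"
proof (rule ccontr)
  assume "\<not> 0 \<le> D"
  have "f' x = 0"
    using DERIV_local_min[OF f'[of x] \<open>0 < d\<close>] min \<open>0 < d\<close>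
    by (simp add: abs_minus_commute)
  moreover obtain e where "e > 0" and e: "\<And>h. 0 < h \<Longrightarrow> h < e \<Longrightarrow> f' (x + h) < f' x"
    using has_real_derivative_neg_dec_right[OF f''] \<open>\<not> 0 \<le> D\<close> by force
  ultimately have neg: "f' (x + h) < 0" if "0 < h" "h < e" for h
    using that by force
  define h where "h = min d e / 2"
  have h: "0 < h" "h < d" "h < e"
    using \<open>0 < d\<close> \<open>0 < e\<close> by (auto simp: h_def min_def)
  have "\<exists>s. x < s \<and> s < x + h \<and> f (x + h) - f x = (x + h - x) * f' s"
    by (rule MVT2) (use h f' in auto)
  then obtain s where s: "x < s" "s < x + h" "f (x + h) - f x = h * f' s"
    by auto
  have "f' s < 0"
    using neg[of "s - x"] s h by auto
  then have "f (x + h) < f x"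
    using s h by (smt (verit) mult_pos_neg)
  then show False
    using min[of "x + h"] h by auto
qed

text \<open>Serves the time direction of the maximum principle: a minimum may sit at the final time,
  where only earlier times can be compared.\<close>

lemma left_derivative_nonpos_at_left_min:
  fixes f :: "real \<Rightarrow> real"
  assumes "a < x" and "(f has_real_derivative D) (at x)"
    and "\<And>y. a \<le> y \<Longrightarrow> y \<le> x \<Longrightarrow> f x \<le> f y"
  shows "D \<le> 0"
proof (rule ccontr)
  assume "\<not> D \<le> 0"
  then obtain e where "e > 0" and e: "\<And>h. 0 < h \<Longrightarrow> h < e \<Longrightarrow> f (x - h) < f x"
    using has_real_derivative_pos_inc_left[OF assms(2)] by force
  define h where "h = min e (x - a) / 2"
  have "0 < h" "h < e" "h < x - a"
    using \<open>0 < e\<close> \<open>a < x\<close> by (auto simp: h_def min_def)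
  then show False
    using e[of h] assms(3)[of "x - h"] by auto
qed

section \<open>Maximum principle and preservation of convexity\<close>

text \<open>The domain is unbounded, so a barrier is needed at infinity. As \<open>a\<close> grows
  at most quadratically, \<open>a * p''\<close> is at most a multiple of \<open>p\<close> for a
  power \<open>p\<close> of \<open>1 + x\<close>; this makes such powers usable as barriers.\<close>

lemma convexity_preserved:
  fixes u ux uxx ut a :: "real \<Rightarrow> real \<Rightarrow> real"
  assumes cont: "continuous_on ({0..} \<times> {0..}) (\<lambda>(x, t). u x t)"
    and ux: "\<And>x t. 0 < x \<Longrightarrow> 0 < t \<Longrightarrow> ((\<lambda>y. u y t) has_real_derivative ux x t) (at x)"
    and uxx: "\<And>x t. 0 < x \<Longrightarrow> 0 < t \<Longrightarrow> ((\<lambda>y. ux y t) has_real_derivative uxx x t) (at x)"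
    and ut: "\<And>x t. 0 < x \<Longrightarrow> 0 < t \<Longrightarrow> ((\<lambda>s. u x s) has_real_derivative ut x t) (at t)"
    and pde: "\<And>x t. 0 < x \<Longrightarrow> 0 < t \<Longrightarrow> ut x t = a x t * uxx x t"
    and a_nonneg: "\<And>x t. 0 < x \<Longrightarrow> 0 < t \<Longrightarrow> 0 \<le> a x t"
    and a_le: "\<And>x t. 0 < x \<Longrightarrow> 0 < t \<Longrightarrow> a x t \<le> M * (1 + x)\<^sup>2"
    and growth: "poly_growth_loc_unif u"
    and bdry: "\<And>t. 0 \<le> t \<Longrightarrow> u 0 t = c"
    and init: "convex_on {0..} (\<lambda>x. u x 0)"
    and "0 \<le> t"
  shows "convex_on {0..} (\<lambda>x. u x t)"
proof -
  define E where "E x z y t = (y - z) * u x t + (z - x) * u y t - (y - x) * u z t" for x z y t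
  obtain C k where C: "\<And>x s. 0 \<le> x \<Longrightarrow> 0 \<le> s \<Longrightarrow> s \<le> t \<Longrightarrow> \<bar>u x s\<bar> \<le> C * (1 + x) ^ k"
    using growth \<open>0 \<le> t\<close> unfolding poly_growth_loc_unif_def by fastforce
  have "C \<ge> 0"
    using C[of 0 0] \<open>0 \<le> t\<close> by auto
  have "0 \<le> a 1 1" "a 1 1 \<le> M * (1 + 1)\<^sup>2"
    by (rule a_nonneg a_le; simp)+
  then have "M \<ge> 0" by simp
  \<comment> \<open>With \<open>u\<close> of order \<open>k\<close>, \<open>E\<close> is of order
    \<open>k + 1\<close> because of its length factors; one more degree makes \<open>p\<close>
    dominate \<open>E\<close> at infinity.\<close>
  define m where "m = k + 2"
  define p where "p x = (1 + x) ^ m" for x :: real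
  define p' where "p' x = real m * (1 + x) ^ (k + 1)" for x :: real
  define p'' where "p'' x = real m * (real (k + 1) * (1 + x) ^ k)" for x :: real
  \<comment> \<open>The product is the constant in the bound of \<open>a * p''\<close> by a multiple
    of \<open>p\<close>; the summand 1 keeps \<open>\<kappa>\<close> positive even if
    \<open>M = 0\<close>.\<close>
  define \<kappa> where "\<kappa> = M * (real m * real (k + 1)) + 1"
  have "\<kappa> > 0"
    using \<open>M \<ge> 0\<close> by (auto simp: \<kappa>_def intro!: add_nonneg_pos mult_nonneg_nonneg)
  have p': "(p has_real_derivative p' x) (at x)" for x
    unfolding p_def[abs_def] p'_def by (rule derivative_eq_intros refl)+ (simp add: m_def)
  have p'': "(p' has_real_derivative p'' x) (at x)" for x
    unfolding p'_def[abs_def] p''_def by (rule derivative_eq_intros refl)+ simp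
  have p_pos: "p x > 0" if "0 \<le> x" for x
    using that by (auto simp: p_def)
  have ap: "a x s * p'' x \<le> \<kappa> * p x" if "0 < x" "0 < s" for x s
  proof -
    have "a x s * p'' x \<le> (M * (1 + x)\<^sup>2) * p'' x"
      using a_le[OF that] that by (intro mult_right_mono) (auto simp: p''_def)
    also have "\<dots> = (\<kappa> - 1) * p x"
      by (simp add: p''_def \<kappa>_def p_def m_def power_add power2_eq_square algebra_simps)
    also have "\<dots> \<le> \<kappa> * p x"
      using p_pos[of x] that by (intro mult_right_mono) auto
    finally show ?thesis .
  qed
  have main: "0 \<le> E x0 z0 y0 t" if ord: "0 \<le> x0" "x0 \<le> z0" "z0 \<le> y0" for x0 z0 y0
  proof (rule ccontr)
    assume neg: "\<not> 0 \<le> E x0 z0 y0 t"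
    define \<phi> where "\<phi> x z y = p x + p z + p y" for x z y
    \<comment> \<open>The exponential factor contributes \<open>- \<kappa> * E\<close> to the time
      derivative, which offsets the error that the barrier \<open>\<phi>\<close> causes in the
      equation.\<close>
    define v where "v \<epsilon> x z y s = exp (- \<kappa> * s) * E x z y s + \<epsilon> * \<phi> x z y" for \<epsilon> x z y s
    have "\<phi> x0 z0 y0 > 0"
      using p_pos ord by (simp add: \<phi>_def add_pos_pos)
    \<comment> \<open>The barrier cancels exactly half of the negative value at the given point, so
      \<open>v\<close> stays negative there.\<close>
    define \<epsilon> where "\<epsilon> = - (exp (- \<kappa> * t) * E x0 z0 y0 t) / (2 * \<phi> x0 z0 y0)"
    have "\<epsilon> > 0"
      using neg \<open>\<phi> x0 z0 y0 > 0\<close> by (auto simp: \<epsilon>_def zero_less_mult_iff divide_neg_pos mult_pos_neg)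
    have "\<epsilon> * \<phi> x0 z0 y0 = - (exp (- \<kappa> * t) * E x0 z0 y0 t) / 2"
      using \<open>\<phi> x0 z0 y0 > 0\<close> by (simp add: \<epsilon>_def)
    moreover have "exp (- \<kappa> * t) * E x0 z0 y0 t < 0"
      using neg by (simp add: mult_pos_neg)
    ultimately have v0: "v \<epsilon> x0 z0 y0 t < 0"
      unfolding v_def by linarith
    \<comment> \<open>Each of the three terms of \<open>E\<close> is at most
      \<open>C * (1 + y) ^ (k + 1)\<close>, and \<open>3 * C < \<epsilon> * (1 + y)\<close> once
      \<open>y\<close> reaches \<open>R\<close>; there the barrier wins.\<close>
    define R where "R = 3 * C / \<epsilon> + y0"
    have far: "0 < v \<epsilon> x z y s"
      if "0 \<le> x" "x \<le> z" "z \<le> y" "R \<le> y" "0 \<le> s" "s \<le> t" for x z y s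
    proof -
      have b: "\<bar>l * u w s\<bar> \<le> C * (1 + y) ^ (k + 1)" if "0 \<le> w" "w \<le> y" "0 \<le> l" "l \<le> y" for w l
      proof -
        have "\<bar>l * u w s\<bar> \<le> (1 + y) * (C * (1 + w) ^ k)"
          unfolding abs_mult using C[of w s] that \<open>0 \<le> s\<close> \<open>s \<le> t\<close> by (intro mult_mono) auto
        also have "\<dots> \<le> (1 + y) * (C * (1 + y) ^ k)"
          using that \<open>C \<ge> 0\<close> by (intro mult_left_mono power_mono) auto
        finally show ?thesis by (simp add: mult_ac)
      qed
      have "\<bar>E x z y s\<bar> \<le> 3 * (C * (1 + y) ^ (k + 1))"
        unfolding E_def using b[of x "y - z"] b[of y "z - x"] b[of z "y - x"] that by linarith
      moreover have "\<bar>exp (- \<kappa> * s) * E x z y s\<bar> \<le> 1 * \<bar>E x z y s\<bar>"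
        unfolding abs_mult using \<open>\<kappa> > 0\<close> \<open>0 \<le> s\<close> by (intro mult_right_mono) auto
      moreover have "3 * C < \<epsilon> * (1 + y)"
        using \<open>\<epsilon> > 0\<close> \<open>R \<le> y\<close> ord unfolding R_def by (simp add: field_simps) (smt (verit) mult_nonneg_nonneg)
      then have "3 * C * (1 + y) ^ (k + 1) < \<epsilon> * (1 + y) * (1 + y) ^ (k + 1)"
        using that by (intro mult_strict_right_mono) auto
      then have "3 * (C * (1 + y) ^ (k + 1)) < \<epsilon> * p y"
        by (simp add: p_def m_def mult_ac)
      moreover have "\<epsilon> * p y \<le> \<epsilon> * \<phi> x z y"
        using \<open>\<epsilon> > 0\<close> p_pos[of x] p_pos[of z] that unfolding \<phi>_def by (intro mult_left_mono) auto
      ultimately show ?thesis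
        unfolding v_def by linarith
    qed
    define Q where "Q = ({0..R} \<times> {0..R} \<times> {0..R} \<times> {0..t}) \<inter>
      {(x, z, y, s). x \<le> z \<and> z \<le> y}"
    \<comment> \<open>Otherwise \<open>far\<close> would make \<open>v\<close> positive at the given
      point.\<close>
    have "y0 < R"
      using far[of x0 z0 y0 t] v0 ord \<open>0 \<le> t\<close> by force
    have "closed {(x, z, y, s :: real). x \<le> z \<and> z \<le> (y :: real)}"
      unfolding case_prod_beta by (intro closed_Collect_conj closed_Collect_le continuous_intros)
    then have "compact Q"
      unfolding Q_def by (intro compact_Int_closed compact_Times) auto
    have Q0: "(x0, z0, y0, t) \<in> Q"
      using ord \<open>y0 < R\<close> \<open>0 \<le> t\<close> by (auto simp: Q_def)
    have cu: "continuous_on Q (\<lambda>q. u (f q) (snd (snd (snd q))))"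
      if "continuous_on Q f" "\<And>q. q \<in> Q \<Longrightarrow> 0 \<le> f q" for f
    proof -
      have "continuous_on Q (\<lambda>q. (\<lambda>(x, t). u x t) (f q, snd (snd (snd q))))"
        by (rule continuous_on_compose2[OF cont])
          (use that in \<open>auto intro!: continuous_intros simp: Q_def\<close>)
      then show ?thesis by simp
    qed
    have "continuous_on Q (\<lambda>q. v \<epsilon> (fst q) (fst (snd q)) (fst (snd (snd q))) (snd (snd (snd q))))"
      unfolding v_def E_def \<phi>_def p_def
      by (intro continuous_intros cu) (auto simp: Q_def)
    then obtain q where "q \<in> Q" and q: "\<And>r. r \<in> Q \<Longrightarrow>
        v \<epsilon> (fst q) (fst (snd q)) (fst (snd (snd q))) (snd (snd (snd q))) \<le>
        v \<epsilon> (fst r) (fst (snd r)) (fst (snd (snd r))) (snd (snd (snd r)))"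
      using continuous_attains_inf[OF \<open>compact Q\<close>] Q0 by blast
    obtain x z y s where q_eq: "q = (x, z, y, s)"
      by (cases q) auto
    have in_Q: "0 \<le> x" "x \<le> z" "z \<le> y" "y \<le> R" "0 \<le> s" "s \<le> t"
      using \<open>q \<in> Q\<close> by (auto simp: q_eq Q_def)
    have min: "v \<epsilon> x z y s \<le> v \<epsilon> x' z' y' s'"
      if "0 \<le> x'" "x' \<le> z'" "z' \<le> y'" "y' \<le> R" "0 \<le> s'" "s' \<le> t" for x' z' y' s'
      using q[of "(x', z', y', s')"] that by (auto simp: q_eq Q_def)
    have vneg: "v \<epsilon> x z y s < 0"
      using q[OF Q0] v0 by (simp add: q_eq)
    have "\<epsilon> * \<phi> x z y > 0"
      using \<open>\<epsilon> > 0\<close> p_pos in_Q by (auto simp: \<phi>_def intro!: mult_pos_pos add_pos_pos)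
    then have Eneg: "E x z y s < 0"
      using vneg unfolding v_def by (smt (verit) exp_gt_zero mult_nonneg_nonneg)
    \<comment> \<open>The minimum is now kept off the boundary: \<open>E\<close> vanishes on both
      diagonals, \<open>far\<close> excludes \<open>y = R\<close>, and convexity of the initial data
      excludes \<open>s = 0\<close>. Only \<open>x = 0\<close> and the final time remain
      possible.\<close>
    have "x \<noteq> z" "z \<noteq> y"
      using Eneg by (auto simp: E_def)
    then have lt: "x < z" "z < y" "0 < z" "0 < y"
      using in_Q by auto
    have "y < R"
      using far[of x z y s] vneg in_Q by force
    have "s \<noteq> 0"
    proof
      assume "s = 0"
      have "u z 0 \<le> (u y 0 - u x 0) / (y - x) * (z - x) + u x 0"
        by (rule convex_onD_Icc'[OF convex_on_subset[OF init]]) (use lt in_Q in auto)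
      then have "(u z 0 - u x 0) * (y - x) \<le> (u y 0 - u x 0) * (z - x)"
        using lt by (simp add: field_simps)
      then show False
        using Eneg \<open>s = 0\<close> by (simp add: E_def algebra_simps)
    qed
    then have "0 < s" using in_Q by auto
    define e where "e = exp (- \<kappa> * s)"
    have "e > 0" by (simp add: e_def)
    \<comment> \<open>Each spatial variable is moved with the others frozen, and the radius
      \<open>d\<close> keeps the ordering and the bounds of \<open>Q\<close>. Up to affine terms,
      \<open>E\<close> is then \<open>u\<close> times \<open>y - z\<close>, \<open>z - x\<close> or
      \<open>- (y - x)\<close>.\<close>
    have x_part: "e * (y - z) * uxx x s + \<epsilon> * p'' x \<ge> 0" if "0 < x"
    proof (rule second_derivative_nonneg_at_local_min
        [where f = "\<lambda>w. v \<epsilon> w z y s" and x = x and d = "min x (z - x)"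
          and f' = "\<lambda>w. e * ((y - z) * ux w s - u y s + u z s) + \<epsilon> * p' w"])
      show "((\<lambda>w. v \<epsilon> w z y s) has_real_derivative
          e * ((y - z) * ux w s - u y s + u z s) + \<epsilon> * p' w) (at w)"
        if "\<bar>w - x\<bar> < min x (z - x)" for w
        unfolding v_def E_def \<phi>_def e_def using that \<open>0 < s\<close>
        by (auto intro!: derivative_eq_intros ux p' simp: algebra_simps)
      show "((\<lambda>w. e * ((y - z) * ux w s - u y s + u z s) + \<epsilon> * p' w) has_real_derivative
          e * (y - z) * uxx x s + \<epsilon> * p'' x) (at x)"
        using that \<open>0 < s\<close>
        by (auto intro!: derivative_eq_intros uxx p'' simp: algebra_simps)
    qed (use that lt in_Q in \<open>auto intro!: min\<close>)
    have y_part: "e * (z - x) * uxx y s + \<epsilon> * p'' y \<ge> 0"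
    proof (rule second_derivative_nonneg_at_local_min
        [where f = "\<lambda>w. v \<epsilon> x z w s" and x = y and d = "min (y - z) (R - y)"
          and f' = "\<lambda>w. e * ((z - x) * ux w s + u x s - u z s) + \<epsilon> * p' w"])
      show "((\<lambda>w. v \<epsilon> x z w s) has_real_derivative
          e * ((z - x) * ux w s + u x s - u z s) + \<epsilon> * p' w) (at w)"
        if "\<bar>w - y\<bar> < min (y - z) (R - y)" for w
        unfolding v_def E_def \<phi>_def e_def using that \<open>0 < s\<close> lt
        by (auto intro!: derivative_eq_intros ux p' simp: algebra_simps)
      show "((\<lambda>w. e * ((z - x) * ux w s + u x s - u z s) + \<epsilon> * p' w) has_real_derivative
          e * (z - x) * uxx y s + \<epsilon> * p'' y) (at y)"
        using lt \<open>0 < s\<close>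
        by (auto intro!: derivative_eq_intros uxx p'' simp: algebra_simps)
    qed (use lt in_Q \<open>y < R\<close> in \<open>auto intro!: min\<close>)
    have z_part: "- (e * (y - x) * uxx z s) + \<epsilon> * p'' z \<ge> 0"
    proof (rule second_derivative_nonneg_at_local_min
        [where f = "\<lambda>w. v \<epsilon> x w y s" and x = z and d = "min (z - x) (y - z)"
          and f' = "\<lambda>w. e * (u y s - u x s - (y - x) * ux w s) + \<epsilon> * p' w"])
      show "((\<lambda>w. v \<epsilon> x w y s) has_real_derivative
          e * (u y s - u x s - (y - x) * ux w s) + \<epsilon> * p' w) (at w)"
        if "\<bar>w - z\<bar> < min (z - x) (y - z)" for w
        unfolding v_def E_def \<phi>_def e_def using that \<open>0 < s\<close> in_Q
        by (auto intro!: derivative_eq_intros ux p' simp: algebra_simps)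
      show "((\<lambda>w. e * (u y s - u x s - (y - x) * ux w s) + \<epsilon> * p' w) has_real_derivative
          - (e * (y - x) * uxx z s) + \<epsilon> * p'' z) (at z)"
        using lt \<open>0 < s\<close>
        by (auto intro!: derivative_eq_intros uxx p'' simp: algebra_simps)
    qed (use lt in_Q in \<open>auto intro!: min\<close>)
    (* On the edge x = 0 the value of u is constant in time, so the corresponding term of the
       equation for E is 0 and this edge needs no separate boundary estimate. *)
    define ut' where "ut' w = (if w = 0 then 0 else ut w s)" for w
    have ut': "((\<lambda>r. u w r) has_real_derivative ut' w) (at s)" if "0 \<le> w" for w
    proof (cases "w = 0")
      case True
      have "((\<lambda>r. u 0 r) has_real_derivative 0) (at s)"
        by (rule has_field_derivative_transform_within[where f = "\<lambda>_. c" and d = s])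
          (use \<open>0 < s\<close> bdry in \<open>auto simp: dist_real_def\<close>)
      then show ?thesis using True by (simp add: ut'_def)
    next
      case False
      then show ?thesis using ut[of w s] that \<open>0 < s\<close> by (simp add: ut'_def)
    qed
    define Et where "Et = (y - z) * ut' x + (z - x) * ut' y - (y - x) * ut' z"
    have "e * Et - \<kappa> * (e * E x z y s) \<le> 0"
    proof (rule left_derivative_nonpos_at_left_min[where f = "\<lambda>r. v \<epsilon> x z y r" and x = s and a = 0])
      show "((\<lambda>r. v \<epsilon> x z y r) has_real_derivative e * Et - \<kappa> * (e * E x z y s)) (at s)"
        unfolding v_def E_def Et_def e_def
        by (rule derivative_eq_intros refl ut' | (use in_Q lt in simp; fail))+
    qed (use \<open>0 < s\<close> in_Q in \<open>auto intro!: min\<close>)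
    \<comment> \<open>Multiplying the second-order condition by \<open>a w s \<ge> 0\<close> turns
      it into a bound on the time derivative; \<open>l\<close> is the factor of \<open>u\<close> at
      \<open>w\<close> in \<open>E\<close>.\<close>
    moreover have part: "e * (l * ut' w) \<ge> - (\<epsilon> * (\<kappa> * p w))"
      if "0 \<le> w" "w > 0 \<Longrightarrow> e * l * uxx w s + \<epsilon> * p'' w \<ge> 0" for l w
    proof (cases "w = 0")
      case True
      then show ?thesis
        using p_pos[of w] \<open>\<kappa> > 0\<close> \<open>\<epsilon> > 0\<close> by (simp add: ut'_def)
    next
      case False
      then have "0 < w" using that by simp
      have "0 \<le> a w s * (e * l * uxx w s + \<epsilon> * p'' w)"
        using that a_nonneg \<open>0 < w\<close> \<open>0 < s\<close> by (intro mult_nonneg_nonneg) auto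
      also have "\<dots> = e * (l * ut' w) + \<epsilon> * (a w s * p'' w)"
        using pde[of w s] \<open>0 < w\<close> \<open>0 < s\<close> by (simp add: ut'_def algebra_simps)
      also have "\<dots> \<le> e * (l * ut' w) + \<epsilon> * (\<kappa> * p w)"
        using ap[of w s] \<open>0 < w\<close> \<open>0 < s\<close> \<open>\<epsilon> > 0\<close> by simp
      finally show ?thesis by simp
    qed
    \<comment> \<open>The sum of the three bounds meets the time condition
      \<open>e * Et \<le> \<kappa> * (e * E x z y s)\<close>; together they give
      \<open>- \<kappa> * v \<le> 0\<close>, contradicting \<open>v < 0\<close>.\<close>
    have "e * Et \<ge> - (\<epsilon> * (\<kappa> * \<phi> x z y))"
      using part[of x "y - z"] part[of y "z - x"] part[of z "- (y - x)"]
        x_part y_part z_part in_Q lt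
      by (simp add: Et_def \<phi>_def algebra_simps)
    ultimately have "0 \<le> \<kappa> * v \<epsilon> x z y s"
      unfolding v_def e_def[symmetric] by (simp add: algebra_simps)
    then show False
      using vneg \<open>\<kappa> > 0\<close> by (simp add: zero_le_mult_iff)
  qed
  show ?thesis
  proof (rule convex_on_linorderI)
    fix l x y :: real
    assume l: "0 < l" "l < 1" and xy: "x \<in> {0..}" "y \<in> {0..}" "x < y"
    define w where "w = (1 - l) * x + l * y"
    have w: "w - x = l * (y - x)" "y - w = (1 - l) * (y - x)"
      by (auto simp: w_def algebra_simps)
    have "0 \<le> w - x" "0 \<le> y - w"
      unfolding w using l xy by auto
    then have "0 \<le> E x w y t"
      using xy by (intro main) auto
    \<comment> \<open>For \<open>w\<close> between \<open>x\<close> and \<open>y\<close>,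
      \<open>E\<close> is the gap in the convexity inequality, scaled by the positive length
      \<open>y - x\<close>.\<close>
    also have "\<dots> = (y - x) * ((1 - l) * u x t + l * u y t - u w t)"
      unfolding E_def w by (simp add: algebra_simps)
    finally show "u ((1 - l) *\<^sub>R x + l *\<^sub>R y) t \<le> (1 - l) * u x t + l * u y t"
      using xy by (simp add: zero_le_mult_iff w_def)
  qed simp
qed

section \<open>Convex functions of one variable\<close>

text \<open>By midpoint convexity the even function \<open>f (x + h) + f (x - h)\<close> of
  \<open>h\<close> is minimal at \<open>h = 0\<close>, where its second derivative is
  \<open>2 * D\<close>.\<close>

lemma convex_on_second_derivative_nonneg:
  fixes f f' :: "real \<Rightarrow> real"
  assumes "convex_on {0..} f" and "0 < x"
    and f': "\<And>y. 0 < y \<Longrightarrow> (f has_real_derivative f' y) (at y)"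
    and f'': "(f' has_real_derivative D) (at x)"
  shows "0 \<le> D"
proof -
  have "0 \<le> D + D"
  proof (rule second_derivative_nonneg_at_local_min
      [where f = "\<lambda>h. f (x + h) + f (x - h)" and x = 0 and d = x
        and f' = "\<lambda>h. f' (x + h) - f' (x - h)"])
    show "((\<lambda>h. f (x + h) + f (x - h)) has_real_derivative f' (x + h) - f' (x - h)) (at h)"
      if "\<bar>h - 0\<bar> < x" for h
      using that by (auto intro!: derivative_eq_intros DERIV_chain2[OF f'])
    show "((\<lambda>h. f' (x + h) - f' (x - h)) has_real_derivative D + D) (at 0)"
      using f'' by (auto intro!: derivative_eq_intros DERIV_chain2[where g = "\<lambda>h. x + h"]
          DERIV_chain2[where g = "\<lambda>h. x - h"])
    show "f (x + 0) + f (x - 0) \<le> f (x + h) + f (x - h)" if "\<bar>h - 0\<bar> < x" for h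
    proof -
      have "(1 - 1/2) *\<^sub>R (x + h) + (1/2) *\<^sub>R (x - h) = x"
        by (simp add: field_simps)
      moreover have "0 \<le> x + h" "0 \<le> x - h"
        using that by auto
      ultimately show ?thesis
        using convex_onD[OF assms(1), of "1/2" "x + h" "x - h"] by simp
    qed
  qed fact
  then show ?thesis by simp
qed

lemma convex_on_chord_slope_from_0_mono:
  fixes f :: "real \<Rightarrow> real"
  assumes "convex_on {0..} f" "0 < x" "x \<le> y"
  shows "(f x - f 0) / x \<le> (f y - f 0) / y"
proof -
  have "f x \<le> (f y - f 0) / (y - 0) * (x - 0) + f 0"
    by (rule convex_onD_Icc'[OF convex_on_subset[OF assms(1)]]) (use assms in auto)
  then show ?thesis
    using assms by (simp add: field_simps)
qed

section \<open>The boundary derivative as an infimum of chord slopes\<close>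

theorem theorem3p1:
  fixes T :: real and \<alpha> u :: "real \<Rightarrow> real \<Rightarrow> real" and g :: "real \<Rightarrow> real"
  assumes "hypothesis_H T \<alpha>"
    and "continuous_on {0..} g"
    and "poly_growth g"
    and "bs_solution T \<alpha> g u"
    and "convex_on {0..} g"
    and "\<exists>D. has_ext_right_derivative g D 0 \<and> D > -\<infinity>"
  shows "\<exists>ux0 :: real \<Rightarrow> real.
    (\<forall>t\<ge>0. ((\<lambda>x. u x t) has_real_derivative ux0 t) (at 0 within {0..})) \<and>
    mono_on {0..} ux0 \<and>
    upper_semicontinuous_on {0..} ux0"
proof -
  have cont: "continuous_on ({0..} \<times> {0..}) (\<lambda>(x, t). u x t)"
    and growth: "poly_growth_loc_unif u"
    and init: "\<And>x. 0 \<le> x \<Longrightarrow> u x 0 = g x"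
    and bdry: "\<And>t. 0 \<le> t \<Longrightarrow> u 0 t = g 0"
    using assms(4) unfolding bs_solution_def by auto
  obtain ux uxx ut where eqs: "\<forall>x>0. \<forall>t>0.
      ((\<lambda>y. u y t) has_real_derivative ux x t) (at x) \<and>
      ((\<lambda>y. ux y t) has_real_derivative uxx x t) (at x) \<and>
      ((\<lambda>s. u x s) has_real_derivative ut x t) (at t) \<and>
      bs_coeff T \<alpha> x t * uxx x t - ut x t = 0"
    using assms(4) unfolding bs_solution_def by blast
  have d: "\<And>x t. 0 < x \<Longrightarrow> 0 < t \<Longrightarrow> ((\<lambda>y. u y t) has_real_derivative ux x t) (at x)"
      "\<And>x t. 0 < x \<Longrightarrow> 0 < t \<Longrightarrow> ((\<lambda>y. ux y t) has_real_derivative uxx x t) (at x)"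
      "\<And>x t. 0 < x \<Longrightarrow> 0 < t \<Longrightarrow> ((\<lambda>s. u x s) has_real_derivative ut x t) (at t)"
    using eqs by blast+
  have pde: "ut x t = bs_coeff T \<alpha> x t * uxx x t" if "0 < x" "0 < t" for x t
    using eqs that by force
  have "\<exists>K. \<forall>x\<ge>0. \<forall>t\<le>T. \<bar>\<alpha> x t\<bar> \<le> K * (1 + x)"
    using assms(1) unfolding hypothesis_H_def by (elim conjE)
  then obtain K where K: "\<And>x t. 0 \<le> x \<Longrightarrow> t \<le> T \<Longrightarrow> \<bar>\<alpha> x t\<bar> \<le> K * (1 + x)"
    by blast
  \<comment> \<open>Squaring the linear growth bound of \<alpha> gives the quadratic bound, with
    \<open>M = K\<^sup>2 / 2\<close>.\<close>
  have coeff_le: "bs_coeff T \<alpha> x t \<le> K\<^sup>2 / 2 * (1 + x)\<^sup>2" if "0 < x" "0 < t" for x t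
    using power_mono[OF K[of x "T - t"], of 2] that
    by (simp add: bs_coeff_def power_mult_distrib)
  have convex_init: "convex_on {0..} (\<lambda>x. u x 0)"
    using assms(5) init unfolding convex_on_def by (simp add: add_nonneg_nonneg)
  have convex: "convex_on {0..} (\<lambda>x. u x t)" if "0 \<le> t" for t
    by (rule convexity_preserved[where a = "bs_coeff T \<alpha>", OF cont d pde _ coeff_le growth bdry convex_init])
      (use that in \<open>auto simp: bs_coeff_def\<close>)
  have cont_t: "continuous_on {0..} (\<lambda>t. u x t)" if "0 \<le> x" for x
  proof -
    have "continuous_on {0..} (\<lambda>t. (\<lambda>(x, t). u x t) (x, t))"
      by (rule continuous_on_compose2[OF cont])
        (use that in \<open>auto intro: continuous_on_Pair continuous_on_const continuous_on_id\<close>)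
    then show ?thesis by simp
  qed
  \<comment> \<open>The equation holds only at positive times, so the sign of \<open>ut\<close> is
    used on the open interval and continuity covers \<open>s = 0\<close>.\<close>
  have mono_t: "u x s \<le> u x t" if "0 < x" "0 \<le> s" "s < t" for x s t
  proof (rule DERIV_nonneg_imp_increasing_open[of s t "u x"])
    fix r assume "s < r" "r < t"
    then have "0 < r" using that by simp
    have "0 \<le> uxx x r"
      using convex_on_second_derivative_nonneg[OF convex \<open>0 < x\<close> d(1) d(2)] \<open>0 < x\<close> \<open>0 < r\<close>
      by simp
    then have "0 \<le> ut x r"
      unfolding pde[OF \<open>0 < x\<close> \<open>0 < r\<close>] by (simp add: bs_coeff_def)
    then show "\<exists>D. (u x has_real_derivative D) (at r) \<and> 0 \<le> D"
      using d(3)[OF \<open>0 < x\<close> \<open>0 < r\<close>] by blast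
  next
    show "continuous_on {s..t} (u x)"
      by (rule continuous_on_subset[OF cont_t]) (use that in auto)
  qed (use that in simp)

  \<comment> \<open>Since \<open>u 0 t = g 0\<close> at all times, this is the chord slope from 0,
    and it depends on time only through \<open>u x t\<close>.\<close>
  define q where "q x t = (u x t - g 0) / x" for x t
  have q_mono_x: "q x t \<le> q y t" if "0 < x" "x \<le> y" "0 \<le> t" for x y t
    using convex_on_chord_slope_from_0_mono[OF convex] that bdry by (simp add: q_def)
  have q_mono_t: "q x s \<le> q x t" if "0 < x" "0 \<le> s" "s \<le> t" for x s t
    using mono_t[of x s t] that by (cases "s = t") (auto simp: q_def divide_right_mono)
  \<comment> \<open>Here g'(0+) > -\<infinity> enters: a real \<open>m\<close> below it bounds the
    initial slopes near 0. Monotonicity of \<open>q\<close> in time carries the bound from time 0 to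
    \<open>t\<close>, and monotonicity in space carries it from a small \<open>y\<close> to
    \<open>x\<close>.\<close>
  obtain m where m: "\<And>x t. 0 < x \<Longrightarrow> 0 \<le> t \<Longrightarrow> m \<le> q x t"
  proof -
    obtain D where D: "((\<lambda>y. ereal ((g y - g 0) / (y - 0))) \<longlongrightarrow> D) (at_right 0)" "D > -\<infinity>"
      using assms(6) unfolding has_ext_right_derivative_def by blast
    obtain m :: real where "ereal m < D"
      using ereal_dense2[OF D(2)] by auto
    then have "\<forall>\<^sub>F y in at_right 0. ereal m < ereal ((g y - g 0) / (y - 0))"
      by (rule order_tendstoD(1)[OF D(1)])
    then obtain b where b: "b > 0" "\<And>y. 0 < y \<Longrightarrow> y < b \<Longrightarrow> m < (g y - g 0) / y"
      unfolding eventually_at_right_field by auto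
    have "m \<le> q x t" if "0 < x" "0 \<le> t" for x t
    proof -
      define y where "y = min x (b / 2)"
      have y: "0 < y" "y \<le> x" "y < b"
        using that b(1) by (auto simp: y_def)
      have "m \<le> q y 0"
        using b(2)[of y] y init by (simp add: q_def)
      also have "\<dots> \<le> q y t"
        using y that by (intro q_mono_t) auto
      also have "\<dots> \<le> q x t"
        using y that by (intro q_mono_x) auto
      finally show ?thesis .
    qed
    then show ?thesis by (rule that)
  qed
  define ux0 where "ux0 t = (INF x\<in>{0<..}. q x t)" for t
  have bdd: "bdd_below ((\<lambda>x. q x t) ` {0<..})" if "0 \<le> t" for t
    using m[OF _ that] by (auto simp: bdd_below_def)
  have ux0_le: "ux0 t \<le> q x t" if "0 \<le> t" "0 < x" for x t
    unfolding ux0_def using bdd that by (intro cINF_lower) auto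
  have ux0_less: "\<exists>x>0. q x t < b" if "0 \<le> t" "ux0 t < b" for t b
    using cINF_less_iff[OF _ bdd[OF that(1)], of b] that(2) unfolding ux0_def by auto
  have "((\<lambda>x. u x t) has_real_derivative ux0 t) (at 0 within {0..})" if "0 \<le> t" for t
  proof -
    \<comment> \<open>A monotone limit: the infimum is a lower bound throughout, and one slope below
      \<open>b\<close> at \<open>x0\<close> forces all slopes at smaller \<open>x\<close> below
      \<open>b\<close>.\<close>
    have "((\<lambda>x. q x t) \<longlongrightarrow> ux0 t) (at_right 0)"
    proof (rule order_tendstoI)
      fix b assume b: "b < ux0 t"
      show "\<forall>\<^sub>F x in at_right 0. b < q x t"
        using eventually_at_right_less[of 0]
        by eventually_elim (rule less_le_trans[OF b ux0_le[OF that]])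
    next
      fix b assume "ux0 t < b"
      then obtain x0 where x0: "x0 > 0" "q x0 t < b"
        using ux0_less[OF \<open>0 \<le> t\<close>] by auto
      then show "\<forall>\<^sub>F x in at_right 0. q x t < b"
        unfolding eventually_at_right_field
        by (intro exI[of _ x0] conjI allI impI le_less_trans[OF q_mono_x x0(2)] x0(1))
          (use that in auto)
    qed
    then show ?thesis
      unfolding has_field_derivative_iff using that bdry
      by (simp add: q_def at_within_Ici_at_right)
  qed
  moreover have "mono_on {0..} ux0"
    unfolding ux0_def by (intro mono_onI cINF_mono bdd) (auto intro: q_mono_t)
  moreover have "upper_semicontinuous_on {0..} ux0"
    unfolding upper_semicontinuous_on_def
  proof (intro ballI allI impI)
    fix t b assume "t \<in> {0..}" "ux0 t < b"
    then obtain x where x: "x > 0" "q x t < b"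
      using ux0_less by auto
    \<comment> \<open>With \<open>x\<close> fixed, the continuous function \<open>q x\<close> stays
      below \<open>b\<close> near \<open>t\<close> and dominates \<open>ux0\<close>. Membership in
      \<open>{0..}\<close> is recorded because that domination holds for nonnegative times.\<close>
    have "continuous_on {0..} (q x)"
      unfolding q_def[abs_def] using x by (intro continuous_intros cont_t) auto
    then have "(q x \<longlongrightarrow> q x t) (at t within {0..})"
      using \<open>t \<in> {0..}\<close> by (simp add: continuous_on_def)
    then have "\<forall>\<^sub>F s in at t within {0..}. q x s < b"
      using x by (simp add: order_tendstoD)
    moreover have "\<forall>\<^sub>F s in at t within {0..}. s \<in> {0..}"
      by (simp add: eventually_at_filter)
    ultimately show "\<forall>\<^sub>F s in at t within {0..}. ux0 s < b"
      by eventually_elim (use ux0_le x in \<open>force intro: le_less_trans\<close>)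
  qed
  ultimately show ?thesis by blast
qed

end
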